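(* Let $C$ be a nonempty closed convex subset of $\mathbb{R}^m$ and let $f:C\times C\to\mathbb{R}$ be a bifunction such that: (i) $f(x,x)=0$ for all $x\in C$, and $f$ is pseudomonotone on $C$, i.e. for all $x,y\in C$, $f(x,y)\ge 0$ implies $f(y,x)\le 0$; (ii) $f$ satisfies a Lipschitz-type condition on $C$: there exist $c_1>0$, $c_2>0$ such that $f(x,y)+f(y,z)\ge f(x,z)-c_1\|x-y\|^2-c_2\|y-z\|^2$ for all $x,y,z\in C$; (iii) $f(\cdot,y)$ is upper semicontinuous for each $y\in C$; (iv) $f(x,\cdot)$ is convex and subdifferentiable on $C$ for each $x\in C$. Let $\varphi=\frac12(\sqrt5+1)$, let $\mu\in(0,\frac12\varphi)$, $\lambda_0>0$, $\bar x_{-1}\in\mathbb{R}^m$ and $x_{-1},x_0\in C$ be chosen arbitrarily, and let $\{x_n\}$ be the sequence generated by the Explicit Golden Ratio Algorithm (described in the context) from these data. Then $\{x_n\}$ converges to some solution of the equilibrium problem, i.e. to some $x^*\in C$ with $f(x^*,y)\ge 0$ for all $y\in C$.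
   Context: The equilibrium problem for $f$ on $C$ is to find $x^*\in C$ such that $f(x^*,y)\ge 0$ for all $y\in C$. For a proper, lower semicontinuous, convex function $g:C\to\mathbb{R}$ and $\lambda>0$, the proximal operator is $$\mathrm{prox}_{\lambda g}(z)=\arg\min\left\{\lambda g(x)+\tfrac12\|x-z\|^2 : x\in C\right\},\quad z\in\mathbb{R}^m.$$ Write $[t]_+=\max\{0,t\}$. Explicit Golden Ratio Algorithm (EGRA). Given $\bar x_{-1}\in\mathbb{R}^m$, $x_{-1},x_0\in C$, $\lambda_0>0$ and $\mu\in(0,\frac12\varphi)$ with $\varphi=\frac12(\sqrt5+1)$, define for $n=0,1,2,\dots$ $$\bar x_n=\frac{(\varphi-1)x_n+\bar x_{n-1}}{\varphi},\qquad x_{n+1}=\mathrm{prox}_{\lambda_n f(x_n,\cdot)}(\bar x_n),$$ $$\lambda_{n+1}=\min\left\{\lambda_n,\ \frac{\mu\left(\|x_{n-1}-x_n\|^2+\|x_n-x_{n+1}\|^2\right)}{2\left[f(x_{n-1},x_{n+1})-f(x_{n-1},x_n)-f(x_n,x_{n+1})\right]_+}\right\}.$$ By convention, whenever the denominator is zero the fraction is interpreted as $+\infty$ (including the case $\frac00=+\infty$), so that $\lambda_{n+1}=\lambda_n$ in that case.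
   Formalization: The formal theorem additionally assumes that the equilibrium problem has a solution; without this the claim is false, e.g. for C = R^m and f(x,y) = y_k − x_k, which satisfies (i)–(iv) but has no solution. *)

theory Defs
  imports "HOL-Analysis.Analysis"
begin

text \<open>Functions on \<open>C\<close> and bifunctions on \<open>C \<times> C\<close> are represented by total functions; every
  notion below only inspects their values on \<open>C\<close>.\<close>

definition equilibrium_solution :: "'a set \<Rightarrow> ('a \<Rightarrow> 'a \<Rightarrow> real) \<Rightarrow> 'a \<Rightarrow> bool" where
  "equilibrium_solution C f xs \<longleftrightarrow> xs \<in> C \<and> (\<forall>y\<in>C. f xs y \<ge> 0)"

definition pseudomonotone_on :: "'a set \<Rightarrow> ('a \<Rightarrow> 'a \<Rightarrow> real) \<Rightarrow> bool" where
  "pseudomonotone_on C f \<longleftrightarrow> (\<forall>x\<in>C. \<forall>y\<in>C. f x y \<ge> 0 \<longrightarrow> f y x \<le> 0)"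

definition lipschitz_type_on :: "'a::real_normed_vector set \<Rightarrow> ('a \<Rightarrow> 'a \<Rightarrow> real) \<Rightarrow> bool" where
  "lipschitz_type_on C f \<longleftrightarrow> (\<exists>c1>0. \<exists>c2>0. \<forall>x\<in>C. \<forall>y\<in>C. \<forall>z\<in>C.
     f x y + f y z \<ge> f x z - c1 * (norm (x - y))\<^sup>2 - c2 * (norm (y - z))\<^sup>2)"

definition upper_semicontinuous_on :: "'a::topological_space set \<Rightarrow> ('a \<Rightarrow> real) \<Rightarrow> bool" where
  "upper_semicontinuous_on S g \<longleftrightarrow> (\<forall>x\<in>S. \<forall>a>g x. \<forall>\<^sub>F y in at x within S. g y < a)"

text \<open>Subgradients are taken relative to \<open>C\<close>: equivalently, \<open>g\<close> is extended by \<open>+\<infinity>\<close> outside \<open>C\<close>.\<close>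

definition subdifferential_on :: "'a::real_inner set \<Rightarrow> ('a \<Rightarrow> real) \<Rightarrow> 'a \<Rightarrow> 'a set" where
  "subdifferential_on C g x = {w. \<forall>y\<in>C. g y \<ge> g x + w \<bullet> (y - x)}"

definition subdifferentiable_on :: "'a::real_inner set \<Rightarrow> ('a \<Rightarrow> real) \<Rightarrow> bool" where
  "subdifferentiable_on C g \<longleftrightarrow> (\<forall>x\<in>C. subdifferential_on C g x \<noteq> {})"

definition prox :: "'a::real_normed_vector set \<Rightarrow> real \<Rightarrow> ('a \<Rightarrow> real) \<Rightarrow> 'a \<Rightarrow> 'a" where
  "prox C lam g z = arg_min_on (\<lambda>x. lam * g x + 1/2 * (norm (x - z))\<^sup>2) C"

definition golden_ratio :: real where
  "golden_ratio = (sqrt 5 + 1) / 2"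

text \<open>The step size update, with arguments \<open>x\<^sub>n\<^sub>-\<^sub>1\<close>, \<open>x\<^sub>n\<close>, \<open>x\<^sub>n\<^sub>+\<^sub>1\<close> and \<open>\<lambda>\<^sub>n\<close>. The conditional implements
  the convention that a fraction with denominator zero is \<open>+\<infinity>\<close>.\<close>

definition egra_step_size ::
  "('a::real_normed_vector \<Rightarrow> 'a \<Rightarrow> real) \<Rightarrow> real \<Rightarrow> 'a \<Rightarrow> 'a \<Rightarrow> 'a \<Rightarrow> real \<Rightarrow> real" where
  "egra_step_size f \<mu> p q r lam =
     (let d = 2 * max 0 (f p r - f p q - f q r) in
      if d = 0 then lam
      else min lam (\<mu> * ((norm (p - q))\<^sup>2 + (norm (q - r))\<^sup>2) / d))"

text \<open>In a run of the algorithm the two sequences that start at index \<open>-1\<close> are shifted by one: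
  \<open>x n\<close> and \<open>xbar n\<close> stand for \<open>x\<^sub>n\<^sub>-\<^sub>1\<close> and its averaged counterpart of index \<open>n - 1\<close>,
  whereas \<open>lam n\<close> is \<open>\<lambda>\<^sub>n\<close>. The initial data are \<open>xbar 0\<close>, \<open>x 0\<close>, \<open>x 1\<close> and \<open>lam 0\<close>.\<close>

definition egra_run ::
  "'a::real_normed_vector set \<Rightarrow> ('a \<Rightarrow> 'a \<Rightarrow> real) \<Rightarrow> real \<Rightarrow>
   (nat \<Rightarrow> 'a) \<Rightarrow> (nat \<Rightarrow> 'a) \<Rightarrow> (nat \<Rightarrow> real) \<Rightarrow> bool" where
  "egra_run C f \<mu> x xbar lam \<longleftrightarrow>
     x 0 \<in> C \<and> x 1 \<in> C \<and> lam 0 > 0 \<and>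
     (\<forall>n. xbar (n + 1) = (1 / golden_ratio) *\<^sub>R ((golden_ratio - 1) *\<^sub>R x (n + 1) + xbar n) \<and>
          x (n + 2) = prox C (lam n) (f (x (n + 1))) (xbar (n + 1)) \<and>
          lam (n + 1) = egra_step_size f \<mu> (x n) (x (n + 1)) (x (n + 2)) (lam n))"

end

theory Submission
  imports Defs
begin

text \<open>Write \<open>\<phi>\<close> for the golden ratio and let \<open>u\<close> be a solution. The proof is a Lyapunov argument for the
  energy \<open>\<phi>\<^sup>2 \<parallel>xbar\<^sub>n - u\<parallel>\<^sup>2 + \<phi>/2 \<parallel>x\<^sub>n - x\<^sub>n\<^sub>-\<^sub>1\<parallel>\<^sup>2\<close>.

  The minimality of a proximal point amounts to a variational inequality
  (\<open>prox_variational_inequality\<close>). It is used for two consecutive iterations: the current one is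
  tested against \<open>u\<close>, where pseudomonotonicity makes \<open>f x\<^sub>n u\<close> nonpositive, and the previous one is
  tested against the next iterate \<open>x\<^sub>n\<^sub>+\<^sub>1\<close>. In the sum of the two, the values of \<open>f\<close> occur only in the
  combination that the step size rule controls by squared increments. What is left
  are inner products; expanding them and using
  \<open>\<phi>\<^sup>2 = \<phi> + 1\<close>, by which \<open>x\<^sub>n\<^sub>+\<^sub>1\<close> is an affine combination of two consecutive averages, gives
  \<open>energy_inequality\<close>.

  Its coefficients involve quotients of consecutive step sizes. The step sizes decrease, and the
  Lipschitz-type condition keeps them away from \<open>0\<close>, so these quotients tend to \<open>1\<close>. The increments then
  appear with coefficients tending to \<open>\<phi> - \<mu>\<close> on the smaller side and to \<open>\<mu>\<close> on the larger side,
  and \<open>\<mu> < \<phi>/2\<close> leaves room for the weight \<open>\<phi>/2\<close> strictly between them. Hence the energy eventually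
  decreases, with a surplus that forces the increments \<open>x\<^sub>n\<^sub>+\<^sub>1 - x\<^sub>n\<close> and the gaps \<open>xbar\<^sub>n - x\<^sub>n\<close> to
  vanish (\<open>eventually_energy_descent\<close>, \<open>energy_converges_and_dissipation_vanishes\<close>).

  The iterates are thus bounded and have a cluster point \<open>v\<close>. Passing to the limit in the variational
  inequality, with upper semicontinuity in the first argument, shows that \<open>v\<close> is itself a
  solution (\<open>cluster_point_is_solution\<close>). So \<open>u\<close> may be replaced by \<open>v\<close>: the energy with respect to \<open>v\<close>
  converges, and it tends to \<open>0\<close> along a subsequence, hence its limit is \<open>0\<close>.\<close>

section \<open>The golden ratio\<close>

lemma golden_ratio_gt_1: "golden_ratio > 1"
proof -
  have "sqrt 5 > sqrt 1"
    by (subst real_sqrt_less_iff) simp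
  then show ?thesis
    unfolding golden_ratio_def by simp
qed

lemma golden_ratio_square: "golden_ratio\<^sup>2 = golden_ratio + 1"
  unfolding golden_ratio_def by (simp add: power2_eq_square field_simps)

text \<open>This trades the average that enters the previous proximal step for the current one, at the cost
  of a factor \<open>golden_ratio\<close>.\<close>

lemma golden_average_offset:
  fixes z z' r :: "'a::real_vector"
  assumes "z' = (1 / golden_ratio) *\<^sub>R ((golden_ratio - 1) *\<^sub>R r + z)"
  shows "z - r = golden_ratio *\<^sub>R (z' - r)"
proof -
  have "golden_ratio *\<^sub>R z' = (golden_ratio - 1) *\<^sub>R r + z"
    using golden_ratio_gt_1 by (simp add: assms)
  then show ?thesis
    by (simp add: algebra_simps)
qed

text \<open>Here \<open>r = \<phi>\<^sup>2 z' - \<phi> z\<close> with \<open>\<phi>\<^sup>2 - \<phi> = 1\<close>, so this is the identity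
  \<open>\<parallel>(1 + t) a - t b\<parallel>\<^sup>2 = (1 + t) \<parallel>a\<parallel>\<^sup>2 - t \<parallel>b\<parallel>\<^sup>2 + t (1 + t) \<parallel>a - b\<parallel>\<^sup>2\<close> for \<open>t = \<phi>\<close>.\<close>

lemma golden_average_norm:
  fixes z z' r u :: "'a::real_inner"
  assumes "z' = (1 / golden_ratio) *\<^sub>R ((golden_ratio - 1) *\<^sub>R r + z)"
  shows "(norm (r - u))\<^sup>2 = golden_ratio\<^sup>2 * (norm (z' - u))\<^sup>2
    - golden_ratio * (norm (z - u))\<^sup>2 + (golden_ratio - 1) * (norm (r - z))\<^sup>2"
proof -
  define g where "g = golden_ratio"
  define a b where "a = r - u" and "b = z - u"
  have g: "g\<^sup>2 = g + 1" "g > 1"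
    using golden_ratio_square golden_ratio_gt_1 by (auto simp: g_def)
  have "golden_ratio *\<^sub>R z' = (golden_ratio - 1) *\<^sub>R r + z"
    using golden_ratio_gt_1 by (simp add: assms)
  then have *: "g *\<^sub>R (z' - u) = (g - 1) *\<^sub>R a + b"
    by (simp add: a_def b_def g_def algebra_simps)
  have "g\<^sup>2 * (norm (z' - u))\<^sup>2 = (norm (g *\<^sub>R (z' - u)))\<^sup>2"
    by (simp add: power_mult_distrib)
  also have "\<dots> = (g - 1)\<^sup>2 * (a \<bullet> a) + 2 * (g - 1) * (a \<bullet> b) + b \<bullet> b"
    unfolding * power2_norm_eq_inner
    by (simp add: inner_add_left inner_add_right inner_commute[of b a] power2_eq_square
        algebra_simps del: scaleR_left_diff_distrib)
  also have "(g - 1)\<^sup>2 = 2 - g"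
    using g(1) by (simp add: power2_eq_square algebra_simps)
  finally have 1: "g\<^sup>2 * (norm (z' - u))\<^sup>2 = (2 - g) * (a \<bullet> a) + 2 * (g - 1) * (a \<bullet> b) + b \<bullet> b" .
  have "r - z = a - b"
    by (simp add: a_def b_def)
  then have 2: "(norm (r - z))\<^sup>2 = a \<bullet> a - 2 * (a \<bullet> b) + b \<bullet> b"
    by (simp add: power2_norm_eq_inner inner_diff_left inner_diff_right inner_commute[of b a])
  show ?thesis
    unfolding g_def[symmetric] 1 2 a_def[symmetric] b_def[symmetric]
    by (simp add: power2_norm_eq_inner algebra_simps)
qed

section \<open>The proximal operator\<close>

lemma convergent_subseq_of_bounded:
  fixes X :: "nat \<Rightarrow> 'a::euclidean_space"
  assumes "\<And>n. norm (X n) \<le> B"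
  obtains l r where "strict_mono r" and "(X \<circ> r) \<longlonglongrightarrow> l"
proof -
  have "bounded (range X)"
    using assms by (auto simp: bounded_iff)
  then show ?thesis
    using bounded_imp_convergent_subsequence that by blast
qed

lemma quadratic_le_imp_le:
  fixes a b t :: real
  assumes "t\<^sup>2 \<le> a * t + b" and "a \<ge> 0" and "b \<ge> 0"
  shows "t \<le> a + b + 1"
proof (rule ccontr)
  assume "\<not> ?thesis"
  then have t: "t > a + b + 1"
    by simp
  have "(t - a) * t > (b + 1) * t"
    using t assms by (intro mult_strict_right_mono) auto
  moreover have "(b + 1) * t \<ge> (b + 1) * 1"
    using t assms by (intro mult_left_mono) auto
  ultimately show False
    using assms(1) by (simp add: power2_eq_square algebra_simps)
qed

text \<open>Subdifferentiability does two jobs. A subgradient at any one point makes the objective dominate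
  a coercive quadratic, so minimizing sequences are bounded; and a subgradient at a cluster point \<open>p\<close> of
  such a sequence provides the lower semicontinuity needed there: the objective at \<open>p\<close> does not exceed
  the limit of the values.\<close>

lemma prox_objective_attains_min:
  fixes C :: "'a::euclidean_space set"
  assumes "C \<noteq> {}" and "closed C" and "lam > 0" and sub: "subdifferentiable_on C g"
  shows "\<exists>p\<in>C. \<forall>y\<in>C. lam * g p + 1/2 * (norm (p - z))\<^sup>2 \<le> lam * g y + 1/2 * (norm (y - z))\<^sup>2"
proof -
  define G where "G = (\<lambda>y. lam * g y + 1/2 * (norm (y - z))\<^sup>2)"
  have subgr: "\<exists>w. \<forall>y\<in>C. g y \<ge> g p + w \<bullet> (y - p)" if "p \<in> C" for p
    using sub that unfolding subdifferentiable_on_def subdifferential_on_def by blast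
  obtain p0 where p0: "p0 \<in> C"
    using assms by blast
  obtain w where w: "\<And>y. y \<in> C \<Longrightarrow> g y \<ge> g p0 + w \<bullet> (y - p0)"
    using subgr[OF p0] by blast
  define K where "K = lam * (g p0 + w \<bullet> (z - p0))"
  have coercive: "G y \<ge> K - lam * norm w * norm (y - z) + 1/2 * (norm (y - z))\<^sup>2" if "y \<in> C" for y
  proof -
    have "w \<bullet> (y - p0) = w \<bullet> (z - p0) + w \<bullet> (y - z)"
      by (simp add: inner_diff_right)
    moreover have "w \<bullet> (y - z) \<ge> - (norm w * norm (y - z))"
      using Cauchy_Schwarz_ineq2[of w "y - z"] by linarith
    ultimately have "g y \<ge> g p0 + w \<bullet> (z - p0) - norm w * norm (y - z)"
      using w[OF that] by linarith
    then have "lam * g y \<ge> lam * (g p0 + w \<bullet> (z - p0) - norm w * norm (y - z))"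
      using \<open>lam > 0\<close> by (intro mult_left_mono) auto
    then show ?thesis
      unfolding G_def K_def by (simp add: algebra_simps)
  qed
  define c where "c = lam * norm w"
  have "c \<ge> 0"
    using \<open>lam > 0\<close> by (simp add: c_def)
  have lower: "G y \<ge> K - c\<^sup>2 / 2" if "y \<in> C" for y
  proof -
    have "(norm (y - z) - c)\<^sup>2 \<ge> 0"
      by simp
    then show ?thesis
      using coercive[OF that] unfolding c_def[symmetric] by (simp add: power2_diff algebra_simps)
  qed
  \<comment> \<open>a minimizing sequence, and its bound from coercivity\<close>
  define m where "m = Inf (G ` C)"
  have bdd: "bdd_below (G ` C)"
    using lower by (intro bdd_belowI2)
  have m_le: "m \<le> G y" if "y \<in> C" for y
    unfolding m_def using bdd that by (intro cInf_lower) auto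
  have "\<exists>y\<in>C. G y < m + 1 / real (Suc n)" for n
  proof -
    have "Inf (G ` C) < m + 1 / real (Suc n)"
      by (simp add: m_def)
    then show ?thesis
      using cInf_lessD[of "G ` C"] \<open>C \<noteq> {}\<close> by blast
  qed
  then obtain X where X: "\<And>n. X n \<in> C" "\<And>n. G (X n) < m + 1 / real (Suc n)"
    by metis
  obtain k where k: "k \<ge> 0" "m + 1 - K \<le> k"
    by (meson abs_ge_self abs_ge_zero)
  have "norm (X n) \<le> norm z + (2 * c + 2 * k + 1)" for n
  proof -
    have "1 / real (Suc n) \<le> 1"
      by simp
    then have "G (X n) < m + 1"
      using X(2)[of n] by linarith
    then have "(norm (X n - z))\<^sup>2 \<le> 2 * c * norm (X n - z) + 2 * k"
      using coercive[OF X(1), of n] k(2)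
      unfolding c_def[symmetric] by (simp add: field_simps)
    then have "norm (X n - z) \<le> 2 * c + 2 * k + 1"
      using \<open>c \<ge> 0\<close> k(1) by (intro quadratic_le_imp_le) auto
    then show ?thesis
      using norm_triangle_sub[of "X n" z] by linarith
  qed
  then obtain r p where r: "strict_mono r" and p: "(X \<circ> r) \<longlonglongrightarrow> p"
    by (rule convergent_subseq_of_bounded)
  have "p \<in> C"
    using \<open>closed C\<close> X(1) p unfolding closed_sequential_limits by (metis comp_apply)
  obtain v where v: "\<And>y. y \<in> C \<Longrightarrow> g y \<ge> g p + v \<bullet> (y - p)"
    using subgr[OF \<open>p \<in> C\<close>] by blast
  have "G p \<le> m"
  proof (rule LIMSEQ_le)
    have "(\<lambda>n. lam * (g p + v \<bullet> ((X \<circ> r) n - p)) + 1/2 * (norm ((X \<circ> r) n - z))\<^sup>2) \<longlonglongrightarrow>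
        lam * (g p + v \<bullet> (p - p)) + 1/2 * (norm (p - z))\<^sup>2"
      by (intro tendsto_intros p)
    then show "(\<lambda>n. lam * (g p + v \<bullet> ((X \<circ> r) n - p)) + 1/2 * (norm ((X \<circ> r) n - z))\<^sup>2) \<longlonglongrightarrow> G p"
      by (simp add: G_def)
    have "(\<lambda>n. m + 1 / real (Suc n)) \<longlonglongrightarrow> m + 0"
      by (intro tendsto_intros LIMSEQ_Suc lim_1_over_n)
    then show "(\<lambda>n. m + 1 / real (Suc (r n))) \<longlonglongrightarrow> m"
      using LIMSEQ_subseq_LIMSEQ[OF _ r, of "\<lambda>n. m + 1 / real (Suc n)"] by (simp add: o_def)
    have "lam * (g p + v \<bullet> (X n - p)) + 1/2 * (norm (X n - z))\<^sup>2 \<le> m + 1 / real (Suc n)" for n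
    proof -
      have "lam * (g p + v \<bullet> (X n - p)) \<le> lam * g (X n)"
        using v[OF X(1)] \<open>lam > 0\<close> by (intro mult_left_mono) auto
      then show ?thesis
        using X(2)[of n] unfolding G_def by linarith
    qed
    then show "\<exists>N. \<forall>n\<ge>N. lam * (g p + v \<bullet> ((X \<circ> r) n - p)) + 1/2 * (norm ((X \<circ> r) n - z))\<^sup>2
        \<le> m + 1 / real (Suc (r n))"
      by simp
  qed
  then have "\<forall>y\<in>C. G p \<le> G y"
    using m_le order_trans by blast
  then show ?thesis
    using \<open>p \<in> C\<close> unfolding G_def by blast
qed

lemma prox_minimizes:
  fixes C :: "'a::euclidean_space set"
  assumes "C \<noteq> {}" and "closed C" and "lam > 0" and "subdifferentiable_on C g"
  shows prox_in: "prox C lam g z \<in> C"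
    and prox_le: "y \<in> C \<Longrightarrow> lam * g (prox C lam g z) + 1/2 * (norm (prox C lam g z - z))\<^sup>2
      \<le> lam * g y + 1/2 * (norm (y - z))\<^sup>2"
proof -
  let ?G = "\<lambda>x. lam * g x + 1/2 * (norm (x - z))\<^sup>2"
  obtain p where "p \<in> C" "\<forall>y\<in>C. ?G p \<le> ?G y"
    using prox_objective_attains_min[OF assms] by blast
  then have "is_arg_min ?G (\<lambda>y. y \<in> C) p"
    by (simp add: is_arg_min_linorder)
  then have *: "is_arg_min ?G (\<lambda>y. y \<in> C) (prox C lam g z)"
    unfolding prox_def arg_min_on_def arg_min_def by (rule someI)
  show "prox C lam g z \<in> C"
    using * by (simp add: is_arg_min_linorder)
  show "y \<in> C \<Longrightarrow> ?G (prox C lam g z) \<le> ?G y"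
    using * by (simp add: is_arg_min_linorder)
qed

lemma norm_add_scaled_square:
  fixes a b :: "'a::real_inner"
  shows "(norm (a + t *\<^sub>R b))\<^sup>2 = (norm a)\<^sup>2 + 2 * t * (a \<bullet> b) + t\<^sup>2 * (norm b)\<^sup>2"
  unfolding power2_norm_eq_inner
  by (simp add: inner_add_left inner_add_right inner_commute[of b a] power2_eq_square algebra_simps)

text \<open>First-order optimality: moving from the minimizer \<open>p\<close> towards \<open>y\<close> by a fraction \<open>t\<close> does not
  decrease the objective. By convexity of \<open>g\<close> the change is at most \<open>t A + t\<^sup>2 B\<close>, where \<open>A\<close> is the
  difference of the two sides of the claim, and \<open>t\<close> can be taken arbitrarily small.\<close>

lemma prox_variational_inequality:
  fixes C :: "'a::euclidean_space set" and z :: 'a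
  assumes "closed C" and "lam > 0" and "subdifferentiable_on C g"
    and conv: "convex_on C g" and "y \<in> C"
  defines "p \<equiv> prox C lam g z"
  shows "(z - p) \<bullet> (y - p) \<le> lam * (g y - g p)"
proof -
  have "C \<noteq> {}"
    using \<open>y \<in> C\<close> by blast
  note prox = prox_minimizes[OF this assms(1-3), where z = z, folded p_def]
  define A where "A = lam * (g y - g p) - (z - p) \<bullet> (y - p)"
  define B where "B = 1/2 * (norm (y - p))\<^sup>2"
  have pos: "A + B * t \<ge> 0" if t: "0 < t" "t \<le> 1" for t
  proof -
    let ?y = "(1 - t) *\<^sub>R p + t *\<^sub>R y"
    have "convex C"
      using conv by (simp add: convex_on_def)
    then have "?y \<in> C"
      using t prox(1) \<open>y \<in> C\<close> by (simp add: convex_def)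
    then have "lam * g p + 1/2 * (norm (p - z))\<^sup>2 \<le> lam * g ?y + 1/2 * (norm (?y - z))\<^sup>2"
      by (rule prox(2))
    moreover have "g ?y \<le> (1 - t) * g p + t * g y"
      using t prox(1) \<open>y \<in> C\<close> by (intro convex_onD[OF conv]) auto
    then have "lam * g ?y \<le> lam * ((1 - t) * g p + t * g y)"
      using \<open>lam > 0\<close> by (intro mult_left_mono) auto
    moreover have "(norm (?y - z))\<^sup>2
        = (norm (p - z))\<^sup>2 - 2 * t * ((z - p) \<bullet> (y - p)) + t\<^sup>2 * (norm (y - p))\<^sup>2"
    proof -
      have eq: "?y - z = (p - z) + t *\<^sub>R (y - p)"
        by (simp add: algebra_simps)
      have neg: "(z - p) \<bullet> (y - p) = - ((p - z) \<bullet> (y - p))"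
        by (simp flip: inner_minus_left)
      show ?thesis
        unfolding eq neg norm_add_scaled_square by simp
    qed
    ultimately have "0 \<le> t * (A + B * t)"
      unfolding A_def B_def by (simp add: algebra_simps power2_eq_square)
    then show ?thesis
      using t by (simp add: zero_le_mult_iff)
  qed
  have "A \<ge> 0"
  proof (rule LIMSEQ_le_const)
    have "(\<lambda>n. A + B * (1 / real (Suc n))) \<longlonglongrightarrow> A + B * 0"
      by (intro tendsto_intros LIMSEQ_Suc lim_1_over_n)
    then show "(\<lambda>n. A + B * (1 / real (Suc n))) \<longlonglongrightarrow> A"
      by simp
    show "\<exists>N. \<forall>n\<ge>N. 0 \<le> A + B * (1 / real (Suc n))"
      by (intro exI allI impI pos) auto
  qed
  then show ?thesis
    by (simp add: A_def)
qed

section \<open>Step sizes\<close>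

lemma egra_step_size_le: "egra_step_size f \<mu> p q r lam \<le> lam"
  by (simp add: egra_step_size_def Let_def)

text \<open>The property the step size is designed for; it also covers the case of a vanishing denominator,
  where the left-hand side is not positive.\<close>

lemma egra_step_size_bound:
  assumes "egra_step_size f \<mu> p q r lam > 0" and "\<mu> \<ge> 0"
  shows "2 * egra_step_size f \<mu> p q r lam * (f p r - f p q - f q r)
    \<le> \<mu> * ((norm (p - q))\<^sup>2 + (norm (q - r))\<^sup>2)"
proof -
  let ?l = "egra_step_size f \<mu> p q r lam" and ?S = "(norm (p - q))\<^sup>2 + (norm (q - r))\<^sup>2"
  show ?thesis
  proof (cases "f p r - f p q - f q r > 0")
    case True
    then have "?l \<le> \<mu> * ?S / (2 * (f p r - f p q - f q r))"
      by (simp add: egra_step_size_def Let_def)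
    then show ?thesis
      using True by (simp add: field_simps)
  next
    case False
    then have "?l * (f p r - f p q - f q r) \<le> 0"
      using assms(1) by (simp add: mult_le_0_iff)
    moreover have "0 \<le> \<mu> * ?S"
      using assms(2) by simp
    ultimately show ?thesis
      by linarith
  qed
qed

lemma egra_step_size_lower:
  assumes "f p r - f p q - f q r \<le> c * ((norm (p - q))\<^sup>2 + (norm (q - r))\<^sup>2)"
    and "c > 0" and "\<mu> > 0"
  shows "egra_step_size f \<mu> p q r lam \<ge> min lam (\<mu> / (2 * c))"
proof -
  let ?S = "(norm (p - q))\<^sup>2 + (norm (q - r))\<^sup>2" and ?D = "f p r - f p q - f q r"
  show ?thesis
  proof (cases "?D > 0")
    case True
    have "\<mu> * ?D \<le> \<mu> * (c * ?S)"
      using assms by (intro mult_left_mono) auto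
    then have "\<mu> / (2 * c) \<le> \<mu> * ?S / (2 * ?D)"
      using True \<open>c > 0\<close> by (simp add: field_simps)
    then show ?thesis
      using True by (simp add: egra_step_size_def Let_def min_def)
  next
    case False
    then show ?thesis
      by (simp add: egra_step_size_def Let_def)
  qed
qed

section \<open>Descent of the energy along a run\<close>

text \<open>The amounts \<open>s n\<close> lost in each step are squeezed between \<open>0\<close> and the differences of consecutive
  members of a convergent sequence.\<close>

lemma descent_convergent:
  fixes E s :: "nat \<Rightarrow> real"
  assumes "\<And>n. E n \<ge> 0" and "\<And>n. s n \<ge> 0"
    and "\<forall>\<^sub>F n in sequentially. E (Suc n) + s n \<le> E n"
  shows "convergent E" and "s \<longlonglongrightarrow> 0"
proof -
  obtain N where N: "\<And>n. n \<ge> N \<Longrightarrow> E (Suc n) + s n \<le> E n"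
    using assms(3) unfolding eventually_sequentially by blast
  have "E (Suc (n + N)) \<le> E (n + N)" for n
    using N[of "n + N"] assms(2)[of "n + N"] by linarith
  then have "decseq (\<lambda>n. E (n + N))"
    by (intro decseq_SucI) simp
  then obtain L where "(\<lambda>n. E (n + N)) \<longlonglongrightarrow> L"
    using decseq_convergent[of "\<lambda>n. E (n + N)" 0] assms(1) by blast
  then have L: "E \<longlonglongrightarrow> L"
    by (rule LIMSEQ_offset)
  then show "convergent E"
    by (auto simp: convergent_def)
  have "(\<lambda>n. E n - E (Suc n)) \<longlonglongrightarrow> L - L"
    by (intro tendsto_diff L LIMSEQ_Suc)
  then have lim: "(\<lambda>n. E n - E (Suc n)) \<longlonglongrightarrow> 0"
    by simp
  have "\<forall>\<^sub>F n in sequentially. s n \<le> E n - E (Suc n)"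
    using assms(3) by eventually_elim simp
  then show "s \<longlonglongrightarrow> 0"
    using assms(2) by (intro tendsto_sandwich[OF _ _ tendsto_const lim]) simp_all
qed

lemma tendsto_zero_of_scaled_square:
  fixes X :: "nat \<Rightarrow> 'a::real_normed_vector"
  assumes "(\<lambda>n. c * (norm (X n))\<^sup>2 + d n) \<longlonglongrightarrow> 0" and "c > 0" and "\<And>n. d n \<ge> 0"
  shows "X \<longlonglongrightarrow> 0"
proof -
  have "(\<lambda>n. (1/c) * (c * (norm (X n))\<^sup>2 + d n)) \<longlonglongrightarrow> (1/c) * 0"
    by (intro tendsto_mult_left assms(1))
  then have lim: "(\<lambda>n. (1/c) * (c * (norm (X n))\<^sup>2 + d n)) \<longlonglongrightarrow> 0"
    by (simp only: mult_zero_right)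
  have "(norm (X n))\<^sup>2 \<le> (1/c) * (c * (norm (X n))\<^sup>2 + d n)" for n
    using assms(2) assms(3)[of n] by (simp add: field_simps)
  then have "(\<lambda>n. (norm (X n))\<^sup>2) \<longlonglongrightarrow> 0"
    by (intro tendsto_sandwich[OF _ _ tendsto_const lim] always_eventually allI) simp_all
  then have "(\<lambda>n. norm (X n)) \<longlonglongrightarrow> 0"
    by (simp add: tendsto_null_power)
  then show ?thesis
    by (rule tendsto_norm_zero_cancel)
qed

locale egra =
  fixes C :: "'a::euclidean_space set"
    and f :: "'a \<Rightarrow> 'a \<Rightarrow> real"
    and \<mu> :: real
    and x xbar :: "nat \<Rightarrow> 'a"
    and lam :: "nat \<Rightarrow> real"
  assumes closed_C: "closed C"
    and pseudomonotone: "pseudomonotone_on C f"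
    and lipschitz_type: "lipschitz_type_on C f"
    and usc: "\<And>y. y \<in> C \<Longrightarrow> upper_semicontinuous_on C (\<lambda>u. f u y)"
    and convex: "\<And>u. u \<in> C \<Longrightarrow> convex_on C (f u)"
    and subdifferentiable: "\<And>u. u \<in> C \<Longrightarrow> subdifferentiable_on C (f u)"
    and mu_pos: "0 < \<mu>" and mu_less: "\<mu> < golden_ratio / 2"
    and run: "egra_run C f \<mu> x xbar lam"
begin

lemma xbar_step: "xbar (n + 1) = (1 / golden_ratio) *\<^sub>R ((golden_ratio - 1) *\<^sub>R x (n + 1) + xbar n)"
  and x_step: "x (n + 2) = prox C (lam n) (f (x (n + 1))) (xbar (n + 1))"
  and lam_step: "lam (n + 1) = egra_step_size f \<mu> (x n) (x (n + 1)) (x (n + 2)) (lam n)"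
  using run unfolding egra_run_def by blast+

lemma lipschitz_constant:
  obtains c where "c > 0"
    and "\<And>p q r. p \<in> C \<Longrightarrow> q \<in> C \<Longrightarrow> r \<in> C \<Longrightarrow>
      f p r - f p q - f q r \<le> c * ((norm (p - q))\<^sup>2 + (norm (q - r))\<^sup>2)"
proof -
  obtain c1 c2 where c: "c1 > 0" "c2 > 0"
    and L: "\<And>p q r. p \<in> C \<Longrightarrow> q \<in> C \<Longrightarrow> r \<in> C \<Longrightarrow>
      f p q + f q r \<ge> f p r - c1 * (norm (p - q))\<^sup>2 - c2 * (norm (q - r))\<^sup>2"
    using lipschitz_type unfolding lipschitz_type_on_def by blast
  have "f p r - f p q - f q r \<le> (c1 + c2) * ((norm (p - q))\<^sup>2 + (norm (q - r))\<^sup>2)"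
    if "p \<in> C" "q \<in> C" "r \<in> C" for p q r
  proof -
    have "0 \<le> c2 * (norm (p - q))\<^sup>2" "0 \<le> c1 * (norm (q - r))\<^sup>2"
      using c by simp_all
    then show ?thesis
      using L[OF that] unfolding distrib_left distrib_right by linarith
  qed
  then show thesis
    using that[of "c1 + c2"] c by simp
qed

lemma x_in_and_lam_bounded:
  "\<exists>l>0. \<forall>n. x n \<in> C \<and> lam n \<ge> l"
proof -
  obtain c where c: "c > 0" and L: "\<And>p q r. p \<in> C \<Longrightarrow> q \<in> C \<Longrightarrow> r \<in> C \<Longrightarrow>
      f p r - f p q - f q r \<le> c * ((norm (p - q))\<^sup>2 + (norm (q - r))\<^sup>2)"
    using lipschitz_constant by blast
  define l where "l = min (lam 0) (\<mu> / (2 * c))"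
  have "l > 0"
    using run c mu_pos by (simp add: l_def egra_run_def)
  have "x n \<in> C \<and> x (n + 1) \<in> C \<and> lam n \<ge> l" for n
  proof (induction n)
    case 0
    then show ?case
      using run by (simp add: egra_run_def l_def)
  next
    case (Suc n)
    then have IH: "x n \<in> C" "x (n + 1) \<in> C" "lam n \<ge> l"
      by auto
    have "x (n + 2) \<in> C"
      unfolding x_step using IH closed_C subdifferentiable \<open>l > 0\<close> by (intro prox_in) auto
    then have "lam (n + 1) \<ge> min (lam n) (\<mu> / (2 * c))"
      unfolding lam_step using IH c mu_pos by (intro egra_step_size_lower L) auto
    then have "lam (n + 1) \<ge> l"
      using IH(3) by (simp add: l_def)
    then show ?case
      using IH \<open>x (n + 2) \<in> C\<close> by simp
  qed
  then show ?thesis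
    using \<open>l > 0\<close> by blast
qed

lemma x_in: "x n \<in> C"
  using x_in_and_lam_bounded by blast

lemma lam_pos: "lam n > 0"
  using x_in_and_lam_bounded less_le_trans by blast

lemma lam_Suc_le: "lam (n + 1) \<le> lam n"
  unfolding lam_step by (rule egra_step_size_le)

lemma lam_limit:
  obtains l where "l > 0" and "lam \<longlonglongrightarrow> l"
proof -
  obtain l where l: "l > 0" "\<And>n. lam n \<ge> l"
    using x_in_and_lam_bounded by blast
  have "decseq lam"
    using lam_Suc_le by (intro decseq_SucI) simp
  then obtain L where L: "lam \<longlonglongrightarrow> L"
    using decseq_convergent[of lam l] l(2) by blast
  then have "L \<ge> l"
    using l(2) by (intro LIMSEQ_le_const[OF L]) auto
  then show thesis
    using that[OF _ L] l(1) by simp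
qed

lemma prox_step:
  assumes "y \<in> C"
  shows "(xbar (n + 1) - x (n + 2)) \<bullet> (y - x (n + 2))
    \<le> lam n * (f (x (n + 1)) y - f (x (n + 1)) (x (n + 2)))"
  unfolding x_step
  by (rule prox_variational_inequality[OF closed_C lam_pos subdifferentiable[OF x_in]
        convex[OF x_in] assms])

lemma previous_prox_step:
  "golden_ratio / lam n * ((xbar (n + 2) - x (n + 2)) \<bullet> (x (n + 3) - x (n + 2)))
    \<le> f (x (n + 1)) (x (n + 3)) - f (x (n + 1)) (x (n + 2))"
proof -
  have "xbar (n + 1) - x (n + 2) = golden_ratio *\<^sub>R (xbar (n + 2) - x (n + 2))"
    using xbar_step[of "n + 1"] by (intro golden_average_offset) (simp only: add.assoc one_add_one)
  then have "golden_ratio * ((xbar (n + 2) - x (n + 2)) \<bullet> (x (n + 3) - x (n + 2)))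
      \<le> lam n * (f (x (n + 1)) (x (n + 3)) - f (x (n + 1)) (x (n + 2)))"
    using prox_step[OF x_in, of n "n + 3"] by (simp only: inner_scaleR_left)
  then show ?thesis
    unfolding times_divide_eq_left pos_divide_le_eq[OF lam_pos] by (simp only: mult.commute[of "lam n"])
qed

text \<open>One step of the algorithm. The sum of the two variational inequalities bounds the inner products
  \<open>(z - r) \<bullet> (u - r)\<close> and \<open>\<theta> (z - q) \<bullet> (r - q)\<close> by the quantity that the step size rule controls. After
  polarization the terms in \<open>\<parallel>r - z\<parallel>\<^sup>2\<close> have total coefficient \<open>1 + (\<phi> - 1) - \<theta>\<close>, which is nonnegative
  because the step sizes decrease.\<close>

lemma energy_inequality:
  fixes n :: nat
  assumes sol: "equilibrium_solution C f u"
  defines "\<theta> \<equiv> golden_ratio * (lam (n + 1) / lam n)"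
    and "\<rho> \<equiv> lam (n + 1) / lam (n + 2)"
  shows "golden_ratio\<^sup>2 * (norm (xbar (n + 3) - u))\<^sup>2
      + (\<theta> - \<mu> * \<rho>) * (norm (x (n + 3) - x (n + 2)))\<^sup>2
      + \<theta> * (norm (xbar (n + 2) - x (n + 2)))\<^sup>2
    \<le> golden_ratio\<^sup>2 * (norm (xbar (n + 2) - u))\<^sup>2
      + \<mu> * \<rho> * (norm (x (n + 2) - x (n + 1)))\<^sup>2"
proof -
  define p q r z where "p = x (n + 1)" and "q = x (n + 2)" and "r = x (n + 3)"
    and "z = xbar (n + 2)"
  define g where "g = golden_ratio"
  have "u \<in> C"
    using sol by (simp add: equilibrium_solution_def)
  have "f u q \<ge> 0"
    using sol x_in by (simp add: equilibrium_solution_def q_def)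
  then have fqu: "f q u \<le> 0"
    using pseudomonotone \<open>u \<in> C\<close> x_in unfolding pseudomonotone_on_def q_def by blast
  have *: "lam (n + 2) = egra_step_size f \<mu> p q r (lam (n + 1))"
    using lam_step[of "n + 1"] by (simp add: p_def q_def r_def numeral_3_eq_3)
  then have "2 * lam (n + 2) * (f p r - f p q - f q r)
      \<le> \<mu> * ((norm (p - q))\<^sup>2 + (norm (q - r))\<^sup>2)"
    using egra_step_size_bound[of f \<mu> p q r "lam (n + 1)"] lam_pos[of "n + 2"] mu_pos by simp
  then have "\<rho> * (2 * lam (n + 2) * (f p r - f p q - f q r))
      \<le> \<rho> * (\<mu> * ((norm (p - q))\<^sup>2 + (norm (q - r))\<^sup>2))"
    using lam_pos[of "n + 1"] lam_pos[of "n + 2"] by (intro mult_left_mono) (auto simp: \<rho>_def)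
  moreover have "\<rho> * (2 * lam (n + 2) * (f p r - f p q - f q r))
      = 2 * lam (n + 1) * (f p r - f p q - f q r)"
    using lam_pos[of "n + 2"] by (simp add: \<rho>_def)
  ultimately have step: "2 * lam (n + 1) * (f p r - f p q - f q r)
      \<le> \<mu> * \<rho> * ((norm (p - q))\<^sup>2 + (norm (q - r))\<^sup>2)"
    by (simp add: algebra_simps)
  \<comment> \<open>the previous proximal step tested against the new iterate, rescaled to the current step size\<close>
  have "lam (n + 1) * (g / lam n * ((z - q) \<bullet> (r - q))) \<le> lam (n + 1) * (f p r - f p q)"
    using previous_prox_step[of n] lam_pos[of "n + 1"]
    by (intro mult_left_mono) (auto simp: p_def q_def r_def z_def g_def)
  then have prev: "\<theta> * ((z - q) \<bullet> (r - q)) \<le> lam (n + 1) * (f p r - f p q)"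
    by (simp add: \<theta>_def g_def mult.assoc mult.left_commute)
  \<comment> \<open>the current proximal step tested against \<open>u\<close>, without the nonpositive term in \<open>f q u\<close>\<close>
  have "(z - r) \<bullet> (u - r) \<le> lam (n + 1) * (f q u - f q r)"
    using prox_step[OF \<open>u \<in> C\<close>, of "n + 1"]
    by (simp add: q_def r_def z_def numeral_3_eq_3)
  moreover have "lam (n + 1) * f q u \<le> 0"
    using fqu lam_pos[of "n + 1"] by (simp add: mult_le_0_iff)
  ultimately have cur: "(z - r) \<bullet> (u - r) \<le> - (lam (n + 1) * f q r)"
    by (simp add: right_diff_distrib)
  have polar: "2 * ((a - b) \<bullet> (c - b)) = (norm (a - b))\<^sup>2 + (norm (c - b))\<^sup>2 - (norm (c - a))\<^sup>2"
    for a b c :: 'a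
    by (simp add: power2_norm_eq_inner inner_diff inner_commute algebra_simps)
  have "2 * ((z - r) \<bullet> (u - r)) + 2 * (\<theta> * ((z - q) \<bullet> (r - q)))
      \<le> \<mu> * \<rho> * ((norm (p - q))\<^sup>2 + (norm (q - r))\<^sup>2)"
    using step prev cur by (simp add: algebra_simps)
  then have "(norm (r - z))\<^sup>2 + (norm (r - u))\<^sup>2 - (norm (z - u))\<^sup>2
      + \<theta> * ((norm (z - q))\<^sup>2 + (norm (r - q))\<^sup>2 - (norm (r - z))\<^sup>2)
      \<le> \<mu> * \<rho> * ((norm (q - p))\<^sup>2 + (norm (r - q))\<^sup>2)"
    using polar[of z r u] polar[of z q r]
    by (simp add: norm_minus_commute mult.left_commute[of 2])
  moreover have "(norm (r - u))\<^sup>2 = g\<^sup>2 * (norm (xbar (n + 3) - u))\<^sup>2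
      - g * (norm (z - u))\<^sup>2 + (g - 1) * (norm (r - z))\<^sup>2"
    using xbar_step[of "n + 2"] unfolding g_def r_def z_def
    by (intro golden_average_norm) (simp add: numeral_3_eq_3)
  moreover have "\<theta> * (norm (r - z))\<^sup>2 \<le> g * (norm (r - z))\<^sup>2"
  proof (rule mult_right_mono)
    have "lam (n + 1) / lam n \<le> 1"
      using lam_Suc_le[of n] lam_pos[of n] by simp
    then show "\<theta> \<le> g"
      unfolding \<theta>_def g_def using golden_ratio_gt_1
      by (intro mult_right_le_one_le[THEN order_trans, OF _ _ _ order_refl]
          less_imp_le[OF divide_pos_pos] lam_pos) auto
  qed simp
  ultimately have "g\<^sup>2 * (norm (xbar (n + 3) - u))\<^sup>2 + (\<theta> - \<mu> * \<rho>) * (norm (r - q))\<^sup>2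
      + \<theta> * (norm (z - q))\<^sup>2
      \<le> (g + 1) * (norm (z - u))\<^sup>2 + \<mu> * \<rho> * (norm (q - p))\<^sup>2"
    by (simp add: algebra_simps)
  then show ?thesis
    using golden_ratio_square by (simp add: g_def p_def q_def r_def z_def)
qed

text \<open>The weight \<open>golden_ratio / 2\<close> lies strictly between the limits \<open>\<mu>\<close> and \<open>golden_ratio - \<mu>\<close> of the
  coefficients of the increments in \<open>energy_inequality\<close>.\<close>

definition energy :: "'a \<Rightarrow> nat \<Rightarrow> real" where
  "energy u n = golden_ratio\<^sup>2 * (norm (xbar (n + 2) - u))\<^sup>2
    + golden_ratio / 2 * (norm (x (n + 2) - x (n + 1)))\<^sup>2"

lemma energy_nonneg: "energy u n \<ge> 0"
  using golden_ratio_gt_1 by (simp add: energy_def)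

text \<open>The first coefficient is half of the margin \<open>(golden_ratio - \<mu>) - golden_ratio / 2\<close> available in
  the limit, the second one half of the limit \<open>golden_ratio\<close>, so that both are available for all late
  steps.\<close>

definition dissipation :: "nat \<Rightarrow> real" where
  "dissipation n = (golden_ratio / 2 - \<mu>) / 2 * (norm (x (n + 3) - x (n + 2)))\<^sup>2
    + golden_ratio / 2 * (norm (xbar (n + 2) - x (n + 2)))\<^sup>2"

lemma dissipation_nonneg: "dissipation n \<ge> 0"
  using golden_ratio_gt_1 mu_less by (simp add: dissipation_def)

lemma eventually_energy_descent:
  assumes sol: "equilibrium_solution C f u"
  shows "\<forall>\<^sub>F n in sequentially. energy u (Suc n) + dissipation n \<le> energy u n"
proof -
  define \<theta> where "\<theta> n = golden_ratio * (lam (n + 1) / lam n)" for n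
  define \<rho> where "\<rho> n = lam (n + 1) / lam (n + 2)" for n
  define \<epsilon> where "\<epsilon> = (golden_ratio / 2 - \<mu>) / 2"
  have "\<epsilon> > 0"
    using mu_less by (simp add: \<epsilon>_def)
  obtain l where "l > 0" and l: "lam \<longlonglongrightarrow> l"
    using lam_limit by blast
  have l1: "(\<lambda>n. lam (n + 1)) \<longlonglongrightarrow> l" and l2: "(\<lambda>n. lam (n + 2)) \<longlonglongrightarrow> l"
    using l by (rule LIMSEQ_ignore_initial_segment)+
  have "\<theta> \<longlonglongrightarrow> golden_ratio * (l / l)"
    unfolding \<theta>_def using \<open>l > 0\<close> by (intro tendsto_intros l l1) auto
  then have \<theta>: "\<theta> \<longlonglongrightarrow> golden_ratio"
    using \<open>l > 0\<close> by simp
  have "\<rho> \<longlonglongrightarrow> l / l"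
    unfolding \<rho>_def using \<open>l > 0\<close> by (intro tendsto_intros l1 l2) auto
  then have "(\<lambda>n. \<mu> * \<rho> n) \<longlonglongrightarrow> \<mu> * 1"
    using \<open>l > 0\<close> by (intro tendsto_intros) auto
  then have \<rho>: "(\<lambda>n. \<mu> * \<rho> n) \<longlonglongrightarrow> \<mu>"
    by simp
  have "\<forall>\<^sub>F n in sequentially. \<theta> n > golden_ratio / 2"
    using golden_ratio_gt_1 by (intro order_tendstoD(1)[OF \<theta>]) simp
  moreover have "\<forall>\<^sub>F n in sequentially. \<mu> * \<rho> n < golden_ratio / 2"
    using mu_less by (intro order_tendstoD(2)[OF \<rho>])
  moreover have "\<forall>\<^sub>F n in sequentially. \<theta> n - \<mu> * \<rho> n > golden_ratio / 2 + \<epsilon>"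
    using \<open>\<epsilon> > 0\<close>
    by (intro order_tendstoD(1)[OF tendsto_diff[OF \<theta> \<rho>]]) (simp add: \<epsilon>_def field_simps)
  ultimately show ?thesis
  proof eventually_elim
    case (elim n)
    have "golden_ratio / 2 * (norm (xbar (n + 2) - x (n + 2)))\<^sup>2
        \<le> \<theta> n * (norm (xbar (n + 2) - x (n + 2)))\<^sup>2"
      using elim(1) by (intro mult_right_mono) auto
    moreover have "\<mu> * \<rho> n * (norm (x (n + 2) - x (n + 1)))\<^sup>2
        \<le> golden_ratio / 2 * (norm (x (n + 2) - x (n + 1)))\<^sup>2"
      using elim(2) by (intro mult_right_mono) auto
    moreover have "(golden_ratio / 2 + \<epsilon>) * (norm (x (n + 3) - x (n + 2)))\<^sup>2
        \<le> (\<theta> n - \<mu> * \<rho> n) * (norm (x (n + 3) - x (n + 2)))\<^sup>2"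
      using elim(3) by (intro mult_right_mono) auto
    moreover have "Suc n + 2 = n + 3" "Suc n + 1 = n + 2"
      by simp_all
    ultimately show ?case
      using energy_inequality[OF sol, of n]
      unfolding energy_def dissipation_def \<theta>_def[symmetric] \<rho>_def[symmetric] \<epsilon>_def[symmetric]
      by (simp only: distrib_right)
  qed
qed

lemma energy_converges_and_dissipation_vanishes:
  assumes "equilibrium_solution C f u"
  shows energy_converges: "convergent (energy u)"
    and dissipation_vanishes: "dissipation \<longlonglongrightarrow> 0"
  by (rule descent_convergent[of "energy u" dissipation,
        OF energy_nonneg[of u] dissipation_nonneg eventually_energy_descent[OF assms]])+

lemma increments_vanish:
  assumes "equilibrium_solution C f u"
  shows "(\<lambda>n. x (n + 1) - x n) \<longlonglongrightarrow> 0"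
proof -
  have "(\<lambda>n. x (n + 3) - x (n + 2)) \<longlonglongrightarrow> 0"
    by (rule tendsto_zero_of_scaled_square[OF dissipation_vanishes[OF assms, unfolded dissipation_def]])
      (use mu_less golden_ratio_gt_1 in auto)
  then show ?thesis
    by (intro LIMSEQ_offset[of "\<lambda>n. x (n + 1) - x n" 2]) (simp add: numeral_3_eq_3)
qed

lemma average_gaps_vanish:
  assumes "equilibrium_solution C f u"
  shows "(\<lambda>n. xbar n - x n) \<longlonglongrightarrow> 0"
proof -
  have lim: "(\<lambda>n. golden_ratio / 2 * (norm (xbar (n + 2) - x (n + 2)))\<^sup>2
      + (golden_ratio / 2 - \<mu>) / 2 * (norm (x (n + 3) - x (n + 2)))\<^sup>2) \<longlonglongrightarrow> 0"
    using dissipation_vanishes[OF assms] unfolding dissipation_def by (simp only: add.commute)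
  have "(\<lambda>n. xbar (n + 2) - x (n + 2)) \<longlonglongrightarrow> 0"
    by (rule tendsto_zero_of_scaled_square[OF lim]) (use mu_less golden_ratio_gt_1 in auto)
  then show ?thesis
    by (rule LIMSEQ_offset)
qed

section \<open>Cluster points and convergence\<close>

lemma iterates_bounded:
  assumes "equilibrium_solution C f u"
  obtains B where "\<And>n. norm (x n) \<le> B"
proof -
  have "convergent (energy u)"
    using assms by (rule energy_converges)
  then have "Bseq (energy u)"
    by (rule convergent_imp_Bseq)
  then obtain K where K: "\<And>n. norm (energy u n) \<le> K"
    unfolding Bseq_def by blast
  have "(norm (xbar (n + 2) - u))\<^sup>2 \<le> K" for n
  proof -
    have "1 * (norm (xbar (n + 2) - u))\<^sup>2 \<le> golden_ratio\<^sup>2 * (norm (xbar (n + 2) - u))\<^sup>2"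
      using golden_ratio_square golden_ratio_gt_1 by (intro mult_right_mono) auto
    also have "\<dots> \<le> energy u n"
      using golden_ratio_gt_1 by (simp add: energy_def)
    finally show ?thesis
      using K[of n] by simp
  qed
  then have a: "norm (xbar (n + 2) - u) \<le> sqrt K" for n
    by (simp add: real_le_rsqrt)
  have "Bseq (\<lambda>n. xbar n - x n)"
    using average_gaps_vanish[OF assms] by (intro convergent_imp_Bseq) (auto simp: convergent_def)
  then obtain L where b: "\<And>n. norm (xbar n - x n) \<le> L"
    unfolding Bseq_def by blast
  have "norm (x (n + 2)) \<le> norm u + sqrt K + L" for n
  proof -
    define v w where "v = xbar (n + 2) - u" and "w = xbar (n + 2) - x (n + 2)"
    have x_eq: "x (n + 2) = (u + v) - w"
      by (simp add: v_def w_def)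
    have "norm (x (n + 2)) \<le> norm u + norm v + norm w"
      unfolding x_eq using norm_triangle_ineq4[of "u + v" w] norm_triangle_ineq[of u v] by linarith
    then show ?thesis
      using a[of n] b[of "n + 2"] unfolding v_def w_def by linarith
  qed
  then have "Bseq (\<lambda>n. x (n + 2))"
    by (rule BseqI')
  then have "Bseq x"
    by (rule Bseq_offset)
  then show thesis
    using that unfolding Bseq_def by blast
qed

text \<open>This carries the limit passage. The variational inequality bounds \<open>f q y\<close> from below by \<open>f q r\<close> up
  to a vanishing term, where \<open>r\<close> is the iterate after \<open>q\<close>. In turn, \<open>f q r\<close> is bounded from below through
  the Lipschitz-type condition by \<open>f p r - f p q\<close>, with \<open>p\<close> the iterate before \<open>q\<close>, and hence by the
  previous proximal step; only increments and gaps remain.\<close>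

lemma values_lower_bound:
  assumes sol: "equilibrium_solution C f u" and "y \<in> C"
  obtains e where "e \<longlonglongrightarrow> 0" and "\<And>n. f (x (n + 2)) y \<ge> e n"
proof -
  obtain c where c: "c > 0" and L: "\<And>p q r. p \<in> C \<Longrightarrow> q \<in> C \<Longrightarrow> r \<in> C \<Longrightarrow>
      f p r - f p q - f q r \<le> c * ((norm (p - q))\<^sup>2 + (norm (q - r))\<^sup>2)"
    using lipschitz_constant by blast
  obtain l where "l > 0" and l: "lam \<longlonglongrightarrow> l"
    using lam_limit by blast
  define d where "d n = x (n + 1) - x n" for n
  define h where "h n = xbar n - x n" for n
  have d: "d \<longlonglongrightarrow> 0" and h: "h \<longlonglongrightarrow> 0"
    unfolding d_def[abs_def] h_def[abs_def]
    by (rule increments_vanish[OF sol] average_gaps_vanish[OF sol])+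
  have d1: "(\<lambda>n. d (n + 1)) \<longlonglongrightarrow> 0" and d2: "(\<lambda>n. d (n + 2)) \<longlonglongrightarrow> 0"
    and h2: "(\<lambda>n. h (n + 2)) \<longlonglongrightarrow> 0" and l1: "(\<lambda>n. lam (n + 1)) \<longlonglongrightarrow> l"
    by (rule LIMSEQ_ignore_initial_segment, fact)+
  obtain B where B: "\<And>n. norm (x n) \<le> B"
    using iterates_bounded[OF sol] by blast
  define e where "e n = golden_ratio / lam n * (h (n + 2) \<bullet> d (n + 2))
    - c * ((norm (d (n + 1)))\<^sup>2 + (norm (d (n + 2)))\<^sup>2)
    - norm (h (n + 2) - d (n + 2)) * (norm y + B) / lam (n + 1)" for n
  have "e \<longlonglongrightarrow> golden_ratio / l * (0 \<bullet> (0::'a)) - c * ((norm (0::'a))\<^sup>2 + (norm (0::'a))\<^sup>2)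
      - norm (0 - (0::'a)) * (norm y + B) / l"
    unfolding e_def using \<open>l > 0\<close> by (intro tendsto_intros l l1 d1 d2 h2) auto
  then have "e \<longlonglongrightarrow> 0"
    by simp
  moreover have "f (x (n + 2)) y \<ge> e n" for n
  proof -
    define p q r where "p = x (n + 1)" and "q = x (n + 2)" and "r = x (n + 3)"
    have C: "p \<in> C" "q \<in> C" "r \<in> C"
      using x_in by (simp_all add: p_def q_def r_def)
    have dd: "d (n + 1) = q - p" "d (n + 2) = r - q" "h (n + 2) = xbar (n + 2) - q"
      by (simp_all add: d_def h_def p_def q_def r_def numeral_3_eq_3)
    have 1: "f q r \<ge> golden_ratio / lam n * (h (n + 2) \<bullet> d (n + 2))
        - c * ((norm (d (n + 1)))\<^sup>2 + (norm (d (n + 2)))\<^sup>2)"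
      using L[OF C] previous_prox_step[of n] unfolding dd
      by (simp add: p_def q_def r_def norm_minus_commute)
    have hd: "h (n + 2) - d (n + 2) = xbar (n + 2) - r"
      unfolding dd by simp
    have "norm (y - r) \<le> norm y + B"
      using norm_triangle_ineq4[of y r] B[of "n + 3"] unfolding r_def by linarith
    then have "norm (xbar (n + 2) - r) * norm (y - r) \<le> norm (xbar (n + 2) - r) * (norm y + B)"
      by (intro mult_left_mono) auto
    moreover have "- (norm (xbar (n + 2) - r) * norm (y - r)) \<le> (xbar (n + 2) - r) \<bullet> (y - r)"
      using Cauchy_Schwarz_ineq2[of "xbar (n + 2) - r" "y - r"] by linarith
    moreover have "(xbar (n + 2) - r) \<bullet> (y - r) \<le> lam (n + 1) * (f q y - f q r)"
      using prox_step[OF \<open>y \<in> C\<close>, of "n + 1"] by (simp add: q_def r_def numeral_3_eq_3)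
    ultimately have "- (norm (xbar (n + 2) - r) * (norm y + B)) \<le> lam (n + 1) * (f q y - f q r)"
      by linarith
    then have "f q y \<ge> f q r - norm (xbar (n + 2) - r) * (norm y + B) / lam (n + 1)"
      using lam_pos[of "n + 1"] by (simp add: field_simps)
    then show ?thesis
      using 1 unfolding e_def hd by (simp add: q_def)
  qed
  ultimately show thesis
    using that by blast
qed

lemma usc_seq_limit:
  assumes "y \<in> C" and "v \<in> C" and X: "\<And>n. X n \<in> C" "X \<longlonglongrightarrow> v"
    and e: "e \<longlonglongrightarrow> (0::real)" "\<And>n. f (X n) y \<ge> e n"
  shows "f v y \<ge> 0"
proof (rule ccontr)
  assume neg: "\<not> f v y \<ge> 0"
  then obtain a where a: "f v y < a" "a < 0"
    using dense[of "f v y" 0] by auto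
  have "\<forall>\<^sub>F w in at v within C. f w y < a"
    using usc[OF \<open>y \<in> C\<close>] \<open>v \<in> C\<close> a(1) unfolding upper_semicontinuous_on_def by blast
  \<comment> \<open>the bound also holds at \<open>v\<close> itself, so the punctured filter can be replaced by \<open>nhds\<close>\<close>
  then have "\<forall>\<^sub>F w in nhds v. w \<in> C \<longrightarrow> f w y < a"
    using a(1) by (auto simp: eventually_at_filter elim: eventually_mono)
  then have "\<forall>\<^sub>F n in sequentially. f (X n) y < a"
    using X by (auto simp: filterlim_iff elim!: allE[of _ "\<lambda>w. w \<in> C \<longrightarrow> f w y < a"])
  moreover have "\<forall>\<^sub>F n in sequentially. a < e n"
    using a(2) by (rule order_tendstoD(1)[OF e(1)])
  ultimately have "\<forall>\<^sub>F n in sequentially. False"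
    by eventually_elim (use e(2) in \<open>meson less_le_trans order_less_asym\<close>)
  then show False
    by simp
qed

lemma cluster_point_is_solution:
  assumes sol: "equilibrium_solution C f u"
    and s: "strict_mono s" "(\<lambda>n. x (s n + 2)) \<longlonglongrightarrow> v"
  shows "equilibrium_solution C f v"
proof -
  have "v \<in> C"
    by (rule closed_sequentially[OF closed_C x_in s(2)])
  moreover have "f v y \<ge> 0" if y: "y \<in> C" for y
  proof -
    obtain e where e: "e \<longlonglongrightarrow> 0" "\<And>n. f (x (n + 2)) y \<ge> e n"
      using values_lower_bound[OF sol y] by blast
    have "(\<lambda>n. e (s n)) \<longlonglongrightarrow> 0"
      using LIMSEQ_subseq_LIMSEQ[OF e(1) s(1)] by (simp add: o_def)
    then show ?thesis
      by (rule usc_seq_limit[OF y \<open>v \<in> C\<close> x_in s(2)]) (rule e(2))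
  qed
  ultimately show ?thesis
    by (simp add: equilibrium_solution_def)
qed

text \<open>A convergent energy that tends to \<open>0\<close> along a subsequence tends to \<open>0\<close>.\<close>

lemma converges_to_cluster_solution:
  assumes sol: "equilibrium_solution C f v"
    and s: "strict_mono s" "(\<lambda>n. x (s n + 2)) \<longlonglongrightarrow> v"
  shows "x \<longlonglongrightarrow> v"
proof -
  have sub: "(\<lambda>n. X (s n)) \<longlonglongrightarrow> a" if "X \<longlonglongrightarrow> a" for X :: "nat \<Rightarrow> 'b::topological_space" and a
    using LIMSEQ_subseq_LIMSEQ[OF that s(1)] by (simp add: o_def)
  note gap = average_gaps_vanish[OF sol]
  have "convergent (energy v)"
    using sol by (rule energy_converges)
  then obtain L where L: "energy v \<longlonglongrightarrow> L"
    by (auto simp: convergent_def)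
  have "(\<lambda>n. (xbar (s n + 2) - x (s n + 2)) + x (s n + 2)) \<longlonglongrightarrow> 0 + v"
    by (intro tendsto_add s(2) sub[of "\<lambda>n. xbar (n + 2) - x (n + 2)"]
        LIMSEQ_ignore_initial_segment[of "\<lambda>n. xbar n - x n"] gap)
  then have xbar_sub: "(\<lambda>n. xbar (s n + 2)) \<longlonglongrightarrow> v"
    by simp
  have "(\<lambda>n. x (n + 2) - x (n + 1)) \<longlonglongrightarrow> 0"
    using LIMSEQ_ignore_initial_segment[OF increments_vanish[OF sol], of 1] by simp
  then have "(\<lambda>n. x (s n + 2) - x (s n + 1)) \<longlonglongrightarrow> 0"
    by (rule sub)
  then have "(\<lambda>n. energy v (s n)) \<longlonglongrightarrow> golden_ratio\<^sup>2 * (norm (v - v))\<^sup>2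
      + golden_ratio / 2 * (norm (0::'a))\<^sup>2"
    unfolding energy_def by (intro tendsto_intros xbar_sub)
  then have "(\<lambda>n. energy v (s n)) \<longlonglongrightarrow> 0"
    by simp
  then have "L = 0"
    using sub[OF L] LIMSEQ_unique by blast
  then have lim: "energy v \<longlonglongrightarrow> 0"
    using L by simp
  have "(\<lambda>n. xbar (n + 2) - v) \<longlonglongrightarrow> 0"
    by (rule tendsto_zero_of_scaled_square[OF lim[unfolded energy_def[abs_def]]])
      (use golden_ratio_gt_1 in auto)
  then have "(\<lambda>n. xbar n - v) \<longlonglongrightarrow> 0"
    by (rule LIMSEQ_offset)
  then have "(\<lambda>n. (xbar n - v) - (xbar n - x n)) \<longlonglongrightarrow> 0 - 0"
    using gap by (rule tendsto_diff)
  then have "(\<lambda>n. x n - v) \<longlonglongrightarrow> 0"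
    by simp
  then show ?thesis
    by (rule LIM_zero_cancel)
qed

theorem converges_to_solution:
  assumes "\<exists>u. equilibrium_solution C f u"
  shows "\<exists>v. equilibrium_solution C f v \<and> x \<longlonglongrightarrow> v"
proof -
  obtain u where u: "equilibrium_solution C f u"
    using assms by blast
  obtain B where "\<And>n. norm (x n) \<le> B"
    using iterates_bounded[OF u] by blast
  then obtain s v where "strict_mono s" and "((\<lambda>n. x (n + 2)) \<circ> s) \<longlonglongrightarrow> v"
    using convergent_subseq_of_bounded[of "\<lambda>n. x (n + 2)"] by blast
  then have s: "strict_mono s" "(\<lambda>n. x (s n + 2)) \<longlonglongrightarrow> v"
    by (simp_all add: o_def)
  have v: "equilibrium_solution C f v"
    using cluster_point_is_solution[OF u s] .
  then show ?thesis
    using converges_to_cluster_solution[OF v s] by blast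
qed

end

theorem theorem1:
  fixes C :: "(real ^ 'm) set"
    and f :: "real ^ 'm \<Rightarrow> real ^ 'm \<Rightarrow> real"
    and \<mu> :: real
    and x xbar :: "nat \<Rightarrow> real ^ 'm"
    and lam :: "nat \<Rightarrow> real"
  assumes "C \<noteq> {}" and "closed C" and "convex C"
    and "\<And>u. u \<in> C \<Longrightarrow> f u u = 0"
    and "pseudomonotone_on C f"
    and "lipschitz_type_on C f"
    and "\<And>y. y \<in> C \<Longrightarrow> upper_semicontinuous_on C (\<lambda>u. f u y)"
    and "\<And>u. u \<in> C \<Longrightarrow> convex_on C (f u)"
    and "\<And>u. u \<in> C \<Longrightarrow> subdifferentiable_on C (f u)"
    and solvable: "\<exists>z. equilibrium_solution C f z"
    and "0 < \<mu>" and "\<mu> < golden_ratio / 2"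
    and "egra_run C f \<mu> x xbar lam"
  shows "\<exists>xs. equilibrium_solution C f xs \<and> x \<longlonglongrightarrow> xs"
proof -
  interpret egra C f \<mu> x xbar lam
    using assms by unfold_locales auto
  show ?thesis
    using solvable by (rule converges_to_solution)
qed

end
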